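(* Let $G=(V,E)$ be a connected locally finite weighted graph with measure $\mu$, and let $\Omega\subset V$ be a bounded domain with $\Omega^{\circ}\neq\emptyset$ and $\partial\Omega\neq\emptyset$. Let $p,q,r>1$, $\lambda_1,\lambda_2,\alpha,\beta>0$, $k\ge0$ with $r<\min\{p,q\}\le (k+1)\max\{p,q\}<\alpha+\beta$; let $M_i(s)=a_i+b_is^k$ with $a_i,b_i>0$, $i=1,2$; let $h_1,h_2,h_3:\Omega\to(0,\infty)$, and let $g_1,g_2:\Omega\to\mathbb{R}$ be continuous functions which may change sign on $\Omega$. Put $H_i=\max_{x\in\Omega}h_i(x)$ for $i=1,2,3$ and $G_i=\max_{x\in\Omega}g_i(x)$ for $i=1,2$. Consider the system $$\begin{cases}-M_1(\|\nabla u\|_p^p)\Delta_pu=\lambda_1 h_1(x)|u|^{r-2}u+\frac{\alpha}{\alpha+\beta}h_2(x)|u|^{\alpha-2}u|v|^{\beta}+g_1(x), & x\in\Omega,\\ -M_2(\|\nabla v\|_q^q)\Delta_qv=\lambda_2 h_3(x)|v|^{r-2}v+\frac{\beta}{\alpha+\beta}h_2(x)|u|^{\alpha}|v|^{\beta-2}v+g_2(x), & x\in\Omega,\\ u(x)=v(x)=0, & x\in\partial\Omega.\end{cases}$$ If $(u_0,0)$ is a semi-trivial solution of this system, then $$a_1\|u_0\|_{W^{1,p}_0(\Omega)}^p+b_1\|u_0\|_{W^{1,p}_0(\Omega)}^{p(k+1)}\le\lambda_1 H_1 C_{1,p}(\Omega)^r\|u_0\|_{W^{1,p}_0(\Omega)}^{r}+G_1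 C_{1,p}(\Omega)\|u_0\|_{W^{1,p}_0(\Omega)}.$$ If $(0,v_0)$ is a semi-trivial solution of this system, then $$a_2\|v_0\|_{W^{1,q}_0(\Omega)}^q+b_2\|v_0\|_{W^{1,q}_0(\Omega)}^{q(k+1)}\le\lambda_2 H_3 C_{1,q}(\Omega)^r\|v_0\|_{W^{1,q}_0(\Omega)}^{r}+G_2 C_{1,q}(\Omega)\|v_0\|_{W^{1,q}_0(\Omega)}.$$
   Context: Graph setting. $G=(V,E)$ is a connected graph in which every vertex has finitely many edges; each edge $xy\in E$ has a weight $\omega_{xy}=\omega_{yx}>0$; $y\sim x$ means $xy\in E$. $\mu:V\to(0,\infty)$ is a (finite) vertex measure with $\mu(x)\ge\mu_0>0$ for all $x$. The distance $d(x,y)$ is the minimal number of edges in a path linking $x$ to $y$. $\Omega\subset V$ is a bounded domain if $d(x,y)$ is uniformly bounded for $x,y\in\Omega$ (so $\Omega$ is finite). $\partial\Omega=\{y\in V\setminus\Omega:\exists x\in\Omega,\ xy\in E\}$ and $\Omega^\circ=\Omega\setminus\partial\Omega$. For $A\subset V$, $\int_A\psi\,d\mu=\sum_{x\in A}\mu(x)\psi(x)$. Operators. $\Gamma(\psi_1,\psi_2)(x)=\frac{1}{2\mu(x)}\sum_{y\sim x}\omega_{xy}(\psi_1(y)-\psi_1(x))(\psi_2(y)-\psi_2(x))$, $|\nabla\psi|(x)=\sqrt{\Gamma(\psi,\psi)(x)}$, and for $l>1$ $$\Delta_l\psi(x)=\frac{1}{2\mu(x)}\sum_{y\sim x}\left(|\nabla\psi|^{l-2}(y)+|\nabla\psi|^{l-2}(x)\right)\omega_{xy}(\psi(y)-\psi(x)).$$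 Convention: a product of a possibly negative power of $0$ with a vanishing factor is read as $0$ (for instance $|\nabla\psi|^{l-2}(x)(\psi(y)-\psi(x))=0$ if $|\nabla\psi|(x)=0$, and $|t|^{s-2}t=0$ at $t=0$). Spaces. $C_c(\Omega)$ is the set of $\psi:V\to\mathbb{R}$ with $\psi=0$ on $V\setminus\Omega$. $\|u\|_{L^\gamma(\Omega)}=(\int_\Omega|u|^\gamma d\mu)^{1/\gamma}$ for $1\le\gamma<\infty$, and $\|u\|_{L^\infty(\Omega)}=\max_{\Omega}|u|$. $W_0^{1,l}(\Omega)$ is the completion of $C_c(\Omega)$ (hence, $\Omega$ being finite, $C_c(\Omega)$ itself) under $\|u\|_{W_0^{1,l}(\Omega)}=\left(\int_{\Omega\cup\partial\Omega}|\nabla u|^l d\mu\right)^{1/l}$. Here $\|\nabla u\|_l^l$ means $\|u\|_{W_0^{1,l}(\Omega)}^l$. $C_{1,l}(\Omega)>0$ denotes a fixed embedding constant depending only on $l$ and $\Omega$ such that $\|u\|_{L^\gamma(\Omega)}\le C_{1,l}(\Omega)\|u\|_{W_0^{1,l}(\Omega)}$ for all $1\le\gamma\le+\infty$ and all $u\in W_0^{1,l}(\Omega)$. Solutions. A solution is a pair $(u,v)\in W_0^{1,p}(\Omega)\times W_0^{1,q}(\Omega)$ satisfying the system pointwise. A semi-trivial solution is a solution $(u,v)\neq(0,0)$ such that one of $u$ and $v$ is identically zero.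
   Formalization: G_i is taken to be the maximum of |g_i| over Ω instead of the maximum of g_i; with the maximum of g_i the estimate is false (for example for g_1 = −1 on a one-vertex Ω). *)

theory Defs
  imports Complex_Main
begin

text \<open>The vertex set is the type \<open>'v\<close>.  The edge set is a symmetric relation; loops are not
  excluded, but they contribute nothing to any of the notions below.\<close>

locale weighted_graph =
  fixes E :: "('v \<times> 'v) set" and \<omega> :: "'v \<Rightarrow> 'v \<Rightarrow> real" and \<mu> :: "'v \<Rightarrow> real"
  assumes edges_sym: "sym E"
    and connected: "(x, y) \<in> E\<^sup>*"
    and locally_finite: "finite {y. (x, y) \<in> E}"
    and weight_pos: "(x, y) \<in> E \<Longrightarrow> \<omega> x y > 0"
    and weight_sym: "(x, y) \<in> E \<Longrightarrow> \<omega> x y = \<omega> y x"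
    and measure_bounded_below: "\<exists>\<mu>\<^sub>0>0. \<forall>x. \<mu> x \<ge> \<mu>\<^sub>0"

definition graph_dist :: "('v \<times> 'v) set \<Rightarrow> 'v \<Rightarrow> 'v \<Rightarrow> nat" where
  "graph_dist E x y = (LEAST n. (x, y) \<in> E ^^ n)"

definition bounded_domain :: "('v \<times> 'v) set \<Rightarrow> 'v set \<Rightarrow> bool" where
  "bounded_domain E \<Omega> \<longleftrightarrow> (\<exists>D. \<forall>x\<in>\<Omega>. \<forall>y\<in>\<Omega>. graph_dist E x y \<le> D)"

definition vertex_boundary :: "('v \<times> 'v) set \<Rightarrow> 'v set \<Rightarrow> 'v set" where
  "vertex_boundary E \<Omega> = {y. y \<notin> \<Omega> \<and> (\<exists>x\<in>\<Omega>. (x, y) \<in> E)}"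

definition vertex_interior :: "('v \<times> 'v) set \<Rightarrow> 'v set \<Rightarrow> 'v set" where
  "vertex_interior E \<Omega> = \<Omega> - vertex_boundary E \<Omega>"

definition vertex_integral :: "('v \<Rightarrow> real) \<Rightarrow> 'v set \<Rightarrow> ('v \<Rightarrow> real) \<Rightarrow> real" where
  "vertex_integral \<mu> A \<psi> = (\<Sum>x\<in>A. \<mu> x * \<psi> x)"

definition grad_form ::
  "('v \<times> 'v) set \<Rightarrow> ('v \<Rightarrow> 'v \<Rightarrow> real) \<Rightarrow> ('v \<Rightarrow> real) \<Rightarrow> ('v \<Rightarrow> real) \<Rightarrow> ('v \<Rightarrow> real) \<Rightarrow> 'v \<Rightarrow> real" where
  "grad_form E \<omega> \<mu> \<psi>\<^sub>1 \<psi>\<^sub>2 x =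
     1 / (2 * \<mu> x) * (\<Sum>y | (x, y) \<in> E. \<omega> x y * (\<psi>\<^sub>1 y - \<psi>\<^sub>1 x) * (\<psi>\<^sub>2 y - \<psi>\<^sub>2 x))"

definition grad_norm ::
  "('v \<times> 'v) set \<Rightarrow> ('v \<Rightarrow> 'v \<Rightarrow> real) \<Rightarrow> ('v \<Rightarrow> real) \<Rightarrow> ('v \<Rightarrow> real) \<Rightarrow> 'v \<Rightarrow> real" where
  "grad_norm E \<omega> \<mu> \<psi> x = sqrt (grad_form E \<omega> \<mu> \<psi> \<psi> x)"

text \<open>Since \<open>0 powr a = 0\<close> for every \<open>a\<close>, a power of a vanishing gradient contributes \<open>0\<close>; it
  only occurs multiplied by a difference \<open>\<psi> y - \<psi> x\<close> that vanishes as well, also for \<open>l = 2\<close>.\<close>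

definition graph_laplacian ::
  "('v \<times> 'v) set \<Rightarrow> ('v \<Rightarrow> 'v \<Rightarrow> real) \<Rightarrow> ('v \<Rightarrow> real) \<Rightarrow> real \<Rightarrow> ('v \<Rightarrow> real) \<Rightarrow> 'v \<Rightarrow> real" where
  "graph_laplacian E \<omega> \<mu> l \<psi> x =
     1 / (2 * \<mu> x) * (\<Sum>y | (x, y) \<in> E.
       (grad_norm E \<omega> \<mu> \<psi> y powr (l - 2) + grad_norm E \<omega> \<mu> \<psi> x powr (l - 2))
         * \<omega> x y * (\<psi> y - \<psi> x))"

text \<open>As \<open>\<Omega>\<close> is finite, the completion \<open>W\<^sub>0\<^sup>1\<^sup>,\<^sup>l(\<Omega>)\<close> of \<open>C\<^sub>c(\<Omega>)\<close> is \<open>C\<^sub>c(\<Omega>)\<close> itself, for every \<open>l\<close>.\<close>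

definition sobolev0 :: "'v set \<Rightarrow> ('v \<Rightarrow> real) set" where
  "sobolev0 \<Omega> = {\<psi>. \<forall>x. x \<notin> \<Omega> \<longrightarrow> \<psi> x = 0}"

definition sobolev0_norm ::
  "('v \<times> 'v) set \<Rightarrow> ('v \<Rightarrow> 'v \<Rightarrow> real) \<Rightarrow> ('v \<Rightarrow> real) \<Rightarrow> 'v set \<Rightarrow> real \<Rightarrow> ('v \<Rightarrow> real) \<Rightarrow> real" where
  "sobolev0_norm E \<omega> \<mu> \<Omega> l u =
     vertex_integral \<mu> (\<Omega> \<union> vertex_boundary E \<Omega>) (\<lambda>x. grad_norm E \<omega> \<mu> u x powr l) powr (1 / l)"

definition Lp_norm :: "('v \<Rightarrow> real) \<Rightarrow> 'v set \<Rightarrow> real \<Rightarrow> ('v \<Rightarrow> real) \<Rightarrow> real" where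
  "Lp_norm \<mu> \<Omega> \<gamma> u = vertex_integral \<mu> \<Omega> (\<lambda>x. \<bar>u x\<bar> powr \<gamma>) powr (1 / \<gamma>)"

definition Linf_norm :: "'v set \<Rightarrow> ('v \<Rightarrow> real) \<Rightarrow> real" where
  "Linf_norm \<Omega> u = Max ((\<lambda>x. \<bar>u x\<bar>) ` \<Omega>)"

definition embedding_constant ::
  "('v \<times> 'v) set \<Rightarrow> ('v \<Rightarrow> 'v \<Rightarrow> real) \<Rightarrow> ('v \<Rightarrow> real) \<Rightarrow> 'v set \<Rightarrow> real \<Rightarrow> real \<Rightarrow> bool" where
  "embedding_constant E \<omega> \<mu> \<Omega> l C \<longleftrightarrow> C > 0 \<and>
     (\<forall>u\<in>sobolev0 \<Omega>.
        (\<forall>\<gamma>\<ge>1. Lp_norm \<mu> \<Omega> \<gamma> u \<le> C * sobolev0_norm E \<omega> \<mu> \<Omega> l u) \<and>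
        Linf_norm \<Omega> u \<le> C * sobolev0_norm E \<omega> \<mu> \<Omega> l u)"

text \<open>\<open>\<bar>t\<bar>\<^sup>s\<^sup>-\<^sup>2 t\<close>, which is \<open>0\<close> at \<open>t = 0\<close>.\<close>

definition signed_power :: "real \<Rightarrow> real \<Rightarrow> real" where
  "signed_power s t = \<bar>t\<bar> powr (s - 2) * t"

text \<open>\<open>M(s) = a + b s\<^sup>k\<close> for \<open>s \<ge> 0\<close>; the case distinction gives \<open>0\<^sup>0 = 1\<close>, whereas \<open>0 powr 0 = 0\<close>.\<close>

definition kirchhoff :: "real \<Rightarrow> real \<Rightarrow> real \<Rightarrow> real \<Rightarrow> real" where
  "kirchhoff a b k s = a + b * (if k = 0 then 1 else s powr k)"

definition kirchhoff_solution ::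
  "('v \<times> 'v) set \<Rightarrow> ('v \<Rightarrow> 'v \<Rightarrow> real) \<Rightarrow> ('v \<Rightarrow> real) \<Rightarrow> 'v set \<Rightarrow> (real \<Rightarrow> real) \<Rightarrow> (real \<Rightarrow> real)
    \<Rightarrow> real \<Rightarrow> real \<Rightarrow> real \<Rightarrow> real \<Rightarrow> real \<Rightarrow> real \<Rightarrow> real
    \<Rightarrow> ('v \<Rightarrow> real) \<Rightarrow> ('v \<Rightarrow> real) \<Rightarrow> ('v \<Rightarrow> real) \<Rightarrow> ('v \<Rightarrow> real) \<Rightarrow> ('v \<Rightarrow> real)
    \<Rightarrow> ('v \<Rightarrow> real) \<Rightarrow> ('v \<Rightarrow> real) \<Rightarrow> bool" where
  "kirchhoff_solution E \<omega> \<mu> \<Omega> M\<^sub>1 M\<^sub>2 p q r lam\<^sub>1 lam\<^sub>2 \<alpha> \<beta> h\<^sub>1 h\<^sub>2 h\<^sub>3 g\<^sub>1 g\<^sub>2 u v \<longleftrightarrow>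
     u \<in> sobolev0 \<Omega> \<and> v \<in> sobolev0 \<Omega> \<and>
     (\<forall>x\<in>\<Omega>.
        - M\<^sub>1 (sobolev0_norm E \<omega> \<mu> \<Omega> p u powr p) * graph_laplacian E \<omega> \<mu> p u x =
          lam\<^sub>1 * h\<^sub>1 x * signed_power r (u x)
          + \<alpha> / (\<alpha> + \<beta>) * h\<^sub>2 x * signed_power \<alpha> (u x) * \<bar>v x\<bar> powr \<beta> + g\<^sub>1 x) \<and>
     (\<forall>x\<in>\<Omega>.
        - M\<^sub>2 (sobolev0_norm E \<omega> \<mu> \<Omega> q v powr q) * graph_laplacian E \<omega> \<mu> q v x =
          lam\<^sub>2 * h\<^sub>3 x * signed_power r (v x)
          + \<beta> / (\<alpha> + \<beta>) * h\<^sub>2 x * \<bar>u x\<bar> powr \<alpha> * signed_power \<beta> (v x) + g\<^sub>2 x) \<and>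
     (\<forall>x\<in>vertex_boundary E \<Omega>. u x = 0 \<and> v x = 0)"

definition semitrivial_solution ::
  "('v \<times> 'v) set \<Rightarrow> ('v \<Rightarrow> 'v \<Rightarrow> real) \<Rightarrow> ('v \<Rightarrow> real) \<Rightarrow> 'v set \<Rightarrow> (real \<Rightarrow> real) \<Rightarrow> (real \<Rightarrow> real)
    \<Rightarrow> real \<Rightarrow> real \<Rightarrow> real \<Rightarrow> real \<Rightarrow> real \<Rightarrow> real \<Rightarrow> real
    \<Rightarrow> ('v \<Rightarrow> real) \<Rightarrow> ('v \<Rightarrow> real) \<Rightarrow> ('v \<Rightarrow> real) \<Rightarrow> ('v \<Rightarrow> real) \<Rightarrow> ('v \<Rightarrow> real)
    \<Rightarrow> ('v \<Rightarrow> real) \<Rightarrow> ('v \<Rightarrow> real) \<Rightarrow> bool" where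
  "semitrivial_solution E \<omega> \<mu> \<Omega> M\<^sub>1 M\<^sub>2 p q r lam\<^sub>1 lam\<^sub>2 \<alpha> \<beta> h\<^sub>1 h\<^sub>2 h\<^sub>3 g\<^sub>1 g\<^sub>2 u v \<longleftrightarrow>
     kirchhoff_solution E \<omega> \<mu> \<Omega> M\<^sub>1 M\<^sub>2 p q r lam\<^sub>1 lam\<^sub>2 \<alpha> \<beta> h\<^sub>1 h\<^sub>2 h\<^sub>3 g\<^sub>1 g\<^sub>2 u v \<and>
     (u, v) \<noteq> (\<lambda>_. 0, \<lambda>_. 0) \<and> (u = (\<lambda>_. 0) \<or> v = (\<lambda>_. 0))"

end

theory Submission
  imports Defs
begin

text \<open>Test the equation of the nontrivial component against that component itself.  The coupling
  term vanishes, and summation by parts turns the left-hand side into \<open>M (N\<^sup>l) N\<^sup>l\<close> with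
  \<open>N\<close> the \<open>W\<^sub>0\<close>-norm.  The embedding with exponents \<open>r\<close> and \<open>1\<close> bounds the right-hand side.\<close>

context weighted_graph
begin

section \<open>Finiteness of bounded domains\<close>

lemma measure_pos: "\<mu> x > 0"
  using measure_bounded_below by (meson less_le_trans)

lemma edge_commute: "(x, y) \<in> E \<longleftrightarrow> (y, x) \<in> E"
  using edges_sym by (meson symD)

lemma finite_relpow_Image: "finite {y. (x, y) \<in> E ^^ n}"
proof (induction n)
  case (Suc n)
  have "{y. (x, y) \<in> E ^^ Suc n} = (\<Union>z\<in>{z. (x, z) \<in> E ^^ n}. {y. (z, y) \<in> E})"
    by auto
  with Suc show ?case
    using locally_finite by simp
qed simp

lemma relpow_graph_dist: "(x, y) \<in> E ^^ graph_dist E x y"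
proof -
  obtain n where "(x, y) \<in> E ^^ n"
    using connected rtrancl_power by blast
  then show ?thesis
    unfolding graph_dist_def by (rule LeastI)
qed

text \<open>Fix one vertex of \<Omega>. Connectedness makes the distance an attained minimum, so
  every vertex of \<Omega> ends a walk of length at most \<open>D\<close> from the fixed one, and
  local finiteness leaves only finitely many such endpoints.\<close>

lemma finite_bounded_domain:
  assumes "bounded_domain E \<Omega>"
  shows "finite \<Omega>"
proof (cases "\<Omega> = {}")
  case False
  then obtain x D where "x \<in> \<Omega>" and D: "\<And>y. y \<in> \<Omega> \<Longrightarrow> graph_dist E x y \<le> D"
    using assms unfolding bounded_domain_def by blast
  have "\<Omega> \<subseteq> (\<Union>n\<le>D. {y. (x, y) \<in> E ^^ n})"
    using D relpow_graph_dist by blast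
  then show ?thesis
    by (rule finite_subset) (simp add: finite_relpow_Image)
qed simp

lemma finite_vertex_boundary:
  assumes "finite \<Omega>"
  shows "finite (vertex_boundary E \<Omega>)"
proof (rule finite_subset)
  show "vertex_boundary E \<Omega> \<subseteq> (\<Union>x\<in>\<Omega>. {y. (x, y) \<in> E})"
    unfolding vertex_boundary_def by blast
qed (simp add: assms locally_finite)

section \<open>The gradient and summation by parts\<close>

lemma grad_form_nonneg: "grad_form E \<omega> \<mu> \<psi> \<psi> x \<ge> 0"
proof -
  have "\<omega> x y * (\<psi> y - \<psi> x) * (\<psi> y - \<psi> x) \<ge> 0" if "(x, y) \<in> E" for y
    using weight_pos[OF that] by (simp add: mult.assoc)
  then show ?thesis
    unfolding grad_form_def using measure_pos[of x]
    by (intro mult_nonneg_nonneg[of "1 / _"] sum_nonneg) auto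
qed

lemma grad_norm_nonneg: "grad_norm E \<omega> \<mu> \<psi> x \<ge> 0"
  unfolding grad_norm_def by (simp add: grad_form_nonneg)

text \<open>Where the gradient is nonzero the form is its square and exponents add. Where it is zero
  both sides are 0, because \<open>0 powr a = 0\<close> for every exponent, including
  \<open>l - 2 \<le> 0\<close>.\<close>

lemma grad_norm_powr_mult_grad_form:
  "grad_norm E \<omega> \<mu> \<psi> x powr (l - 2) * grad_form E \<omega> \<mu> \<psi> \<psi> x = grad_norm E \<omega> \<mu> \<psi> x powr l"
proof (cases "grad_norm E \<omega> \<mu> \<psi> x = 0")
  case False
  then have "grad_form E \<omega> \<mu> \<psi> \<psi> x = grad_norm E \<omega> \<mu> \<psi> x powr 2"
    using grad_norm_nonneg[of \<psi> x] by (simp add: grad_norm_def grad_form_nonneg)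
  then show ?thesis
    by (simp flip: powr_add)
qed simp

text \<open>Green's formula with test function \<phi>. Both sides become sums over ordered edges
  inside \<Omega> and its boundary; the boundary terms vanish with \<phi>, and symmetrising in the
  two endpoints matches the summands.\<close>

lemma integral_graph_laplacian:
  assumes "finite \<Omega>" and \<phi>: "\<phi> \<in> sobolev0 \<Omega>" and \<psi>: "\<psi> \<in> sobolev0 \<Omega>"
  shows "vertex_integral \<mu> \<Omega> (\<lambda>x. graph_laplacian E \<omega> \<mu> l \<psi> x * \<phi> x) =
    - vertex_integral \<mu> (\<Omega> \<union> vertex_boundary E \<Omega>)
        (\<lambda>x. grad_norm E \<omega> \<mu> \<psi> x powr (l - 2) * grad_form E \<omega> \<mu> \<psi> \<phi> x)"
proof -
  define A where "A = \<Omega> \<union> vertex_boundary E \<Omega>"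
  \<comment> \<open>Unlike the set of all edges starting in \<open>A\<close>, this set is invariant
    under reversing edges, which \<open>swap\<close> exploits.\<close>
  define P where "P = {(x, y). x \<in> A \<and> y \<in> A \<and> (x, y) \<in> E}"
  define c where "c x = grad_norm E \<omega> \<mu> \<psi> x powr (l - 2)" for x
  \<comment> \<open>\<open>F\<close> and \<open>D\<close> are the edge summands of the left and
    right integrals, with the measure cancelled and the common factor 1/2 pulled out.\<close>
  define F where "F x y = (c y + c x) * \<omega> x y * (\<psi> y - \<psi> x) * \<phi> x" for x y
  define D where "D x y = c x * (\<omega> x y * (\<psi> y - \<psi> x) * (\<phi> y - \<phi> x))" for x y
  have A: "finite A"
    unfolding A_def using \<open>finite \<Omega>\<close> finite_vertex_boundary by simp
  have in_A: "y \<in> A" if "x \<in> \<Omega>" "(x, y) \<in> E" for x y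
    using that unfolding A_def vertex_boundary_def by blast
  have zero: "\<phi> x = 0" "\<psi> x = 0" if "x \<notin> \<Omega>" for x
    using that \<phi> \<psi> unfolding sobolev0_def by auto
  have sum_P: "(\<Sum>x\<in>A. \<Sum>y | (x, y) \<in> E. f x y) = (\<Sum>(x, y)\<in>P. f x y)"
    if "\<And>x y. x \<in> A \<Longrightarrow> y \<notin> A \<Longrightarrow> (x, y) \<in> E \<Longrightarrow> f x y = 0" for f :: "'v \<Rightarrow> 'v \<Rightarrow> real"
  proof -
    have "(\<Sum>x\<in>A. \<Sum>y | (x, y) \<in> E. f x y) = (\<Sum>x\<in>A. \<Sum>y | y \<in> A \<and> (x, y) \<in> E. f x y)"
      by (rule sum.cong[OF refl], rule sum.mono_neutral_right) (use that locally_finite in blast)+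
    also have "\<dots> = (\<Sum>(x, y)\<in>Sigma A (\<lambda>x. {y. y \<in> A \<and> (x, y) \<in> E}). f x y)"
      using A by (intro sum.Sigma) auto
    also have "Sigma A (\<lambda>x. {y. y \<in> A \<and> (x, y) \<in> E}) = P"
      unfolding P_def by auto
    finally show ?thesis .
  qed
  have swap: "(\<Sum>(x, y)\<in>P. f x y) = (\<Sum>(x, y)\<in>P. f y x)" for f :: "'v \<Rightarrow> 'v \<Rightarrow> real"
    by (rule sum.reindex_bij_witness[of _ prod.swap prod.swap])
       (auto simp: P_def edge_commute)
  have lap: "vertex_integral \<mu> \<Omega> (\<lambda>x. graph_laplacian E \<omega> \<mu> l \<psi> x * \<phi> x)
      = (1/2) * (\<Sum>(x, y)\<in>P. F x y)"
  proof -
    have "vertex_integral \<mu> \<Omega> (\<lambda>x. graph_laplacian E \<omega> \<mu> l \<psi> x * \<phi> x)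
      = (\<Sum>x\<in>\<Omega>. (1/2) * (\<Sum>y | (x, y) \<in> E. F x y))"
      unfolding vertex_integral_def
    proof (rule sum.cong[OF refl])
      fix x
      show "\<mu> x * (graph_laplacian E \<omega> \<mu> l \<psi> x * \<phi> x) = (1/2) * (\<Sum>y | (x, y) \<in> E. F x y)"
        using measure_pos[of x]
        by (simp add: graph_laplacian_def F_def c_def flip: sum_distrib_right)
    qed
    also have "\<dots> = (1/2) * (\<Sum>x\<in>A. \<Sum>y | (x, y) \<in> E. F x y)"
      unfolding sum_distrib_left[symmetric]
      \<comment> \<open>Enlarging the outer sum from \<Omega> to \<open>A\<close> adds only boundary
        vertices, where \<phi> vanishes.\<close>
      by (intro arg_cong[where f = "(*) _"] sum.mono_neutral_left A)
         (auto simp: A_def F_def zero)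
    also have "(\<Sum>x\<in>A. \<Sum>y | (x, y) \<in> E. F x y) = (\<Sum>(x, y)\<in>P. F x y)"
      by (rule sum_P) (metis F_def in_A zero(1) mult_zero_right)
    finally show ?thesis .
  qed
  have form: "vertex_integral \<mu> A (\<lambda>x. c x * grad_form E \<omega> \<mu> \<psi> \<phi> x)
      = (1/2) * (\<Sum>(x, y)\<in>P. D x y)"
  proof -
    have "vertex_integral \<mu> A (\<lambda>x. c x * grad_form E \<omega> \<mu> \<psi> \<phi> x)
      = (\<Sum>x\<in>A. (1/2) * (\<Sum>y | (x, y) \<in> E. D x y))"
      unfolding vertex_integral_def
    proof (rule sum.cong[OF refl])
      fix x
      show "\<mu> x * (c x * grad_form E \<omega> \<mu> \<psi> \<phi> x) = (1/2) * (\<Sum>y | (x, y) \<in> E. D x y)"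
        using measure_pos[of x]
        by (simp add: grad_form_def D_def flip: sum_distrib_left)
    qed
    also have "\<dots> = (1/2) * (\<Sum>x\<in>A. \<Sum>y | (x, y) \<in> E. D x y)"
      by (simp add: sum_distrib_left)
    also have "(\<Sum>x\<in>A. \<Sum>y | (x, y) \<in> E. D x y) = (\<Sum>(x, y)\<in>P. D x y)"
    proof (rule sum_P)
      fix x y
      assume "x \<in> A" "y \<notin> A" "(x, y) \<in> E"
      \<comment> \<open>All neighbours of \<Omega> lie in \<open>A\<close>, so an edge leaving
        \<open>A\<close> starts on the boundary and has both ends outside \<Omega>; the differences
        along it are zero.\<close>
      then have "x \<notin> \<Omega>" "y \<notin> \<Omega>"
        using in_A by (auto simp: A_def)
      then show "D x y = 0"
        by (simp add: D_def zero)
    qed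
    finally show ?thesis .
  qed
  have "2 * (\<Sum>(x, y)\<in>P. F x y) = (\<Sum>(x, y)\<in>P. F x y + F y x)"
    using swap[of F] by (simp add: sum.distrib case_prod_unfold)
  \<comment> \<open>The coefficient \<open>c x + c y\<close> and the weight are symmetric while
    \<open>\<psi> y - \<psi> x\<close> changes sign under the swap, so \<phi> enters only through
    \<open>\<phi> x - \<phi> y\<close>.\<close>
  also have "\<dots> = (\<Sum>(x, y)\<in>P. - (D x y + D y x))"
  proof (intro sum.cong refl, clarify)
    fix x y
    assume "(x, y) \<in> P"
    then have "\<omega> y x = \<omega> x y"
      using weight_sym[of x y] by (simp add: P_def)
    then show "F x y + F y x = - (D x y + D y x)"
      by (simp add: F_def D_def algebra_simps)
  qed
  also have "\<dots> = - 2 * (\<Sum>(x, y)\<in>P. D x y)"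
    using swap[of D] by (simp add: sum.distrib sum_negf sum_subtractf case_prod_unfold)
  finally show ?thesis
    using lap form by (simp add: A_def c_def)
qed

section \<open>Norms as integrals and the a priori estimate\<close>

lemma sobolev0_norm_powr:
  assumes "l > 0"
  shows "sobolev0_norm E \<omega> \<mu> \<Omega> l u powr l =
    vertex_integral \<mu> (\<Omega> \<union> vertex_boundary E \<Omega>) (\<lambda>x. grad_norm E \<omega> \<mu> u x powr l)"
proof -
  have "vertex_integral \<mu> (\<Omega> \<union> vertex_boundary E \<Omega>) (\<lambda>x. grad_norm E \<omega> \<mu> u x powr l) \<ge> 0"
    unfolding vertex_integral_def by (intro sum_nonneg) (simp add: less_imp_le measure_pos)
  then show ?thesis
    using assms by (simp add: sobolev0_norm_def powr_powr)
qed

lemma Lp_norm_powr: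
  assumes "\<gamma> > 0"
  shows "Lp_norm \<mu> \<Omega> \<gamma> u powr \<gamma> = vertex_integral \<mu> \<Omega> (\<lambda>x. \<bar>u x\<bar> powr \<gamma>)"
proof -
  have "vertex_integral \<mu> \<Omega> (\<lambda>x. \<bar>u x\<bar> powr \<gamma>) \<ge> 0"
    unfolding vertex_integral_def by (intro sum_nonneg) (simp add: less_imp_le measure_pos)
  then show ?thesis
    using assms by (simp add: Lp_norm_def powr_powr)
qed

text \<open>Green's formula with \<open>u\<close> as its own test function.\<close>

lemma sobolev0_norm_powr_eq_laplacian:
  assumes "finite \<Omega>" "u \<in> sobolev0 \<Omega>" "l > 0"
  shows "sobolev0_norm E \<omega> \<mu> \<Omega> l u powr l =
    - vertex_integral \<mu> \<Omega> (\<lambda>x. graph_laplacian E \<omega> \<mu> l u x * u x)"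
  using assms
  by (simp add: sobolev0_norm_powr integral_graph_laplacian grad_norm_powr_mult_grad_form)

text \<open>The embedding inequality raised to the power \<gamma>, the form in which it meets the
  integrals of the tested equation.\<close>

lemma embedding_integral_le:
  assumes "embedding_constant E \<omega> \<mu> \<Omega> l C" "u \<in> sobolev0 \<Omega>" "\<gamma> \<ge> 1"
  shows "vertex_integral \<mu> \<Omega> (\<lambda>x. \<bar>u x\<bar> powr \<gamma>) \<le> C powr \<gamma> * sobolev0_norm E \<omega> \<mu> \<Omega> l u powr \<gamma>"
proof -
  have "Lp_norm \<mu> \<Omega> \<gamma> u \<le> C * sobolev0_norm E \<omega> \<mu> \<Omega> l u"
    using assms unfolding embedding_constant_def by blast
  then have "Lp_norm \<mu> \<Omega> \<gamma> u powr \<gamma> \<le> (C * sobolev0_norm E \<omega> \<mu> \<Omega> l u) powr \<gamma>"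
    using assms(3) by (intro powr_mono2) (auto simp: Lp_norm_def)
  moreover have "(C * sobolev0_norm E \<omega> \<mu> \<Omega> l u) powr \<gamma> = C powr \<gamma> * sobolev0_norm E \<omega> \<mu> \<Omega> l u powr \<gamma>"
    by (rule powr_mult)
  ultimately show ?thesis
    using assms(3) by (simp add: Lp_norm_powr)
qed

text \<open>A scalar equation without coupling term, so that one estimate serves both components,
  with \<open>l\<close> equal to \<open>p\<close> or \<open>q\<close>.\<close>

lemma kirchhoff_equation_estimate:
  assumes fin: "finite \<Omega>" and "\<Omega> \<noteq> {}" and u: "u \<in> sobolev0 \<Omega>"
    and "l > 0" and "r \<ge> 1" and "lam \<ge> 0"
    and h: "\<And>x. x \<in> \<Omega> \<Longrightarrow> h x \<ge> 0"
    and C: "embedding_constant E \<omega> \<mu> \<Omega> l C"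
    and eq: "\<And>x. x \<in> \<Omega> \<Longrightarrow>
      - kirchhoff a b k (sobolev0_norm E \<omega> \<mu> \<Omega> l u powr l) * graph_laplacian E \<omega> \<mu> l u x =
      lam * h x * signed_power r (u x) + g x"
  shows "a * sobolev0_norm E \<omega> \<mu> \<Omega> l u powr l + b * sobolev0_norm E \<omega> \<mu> \<Omega> l u powr (l * (k + 1))
    \<le> lam * Max (h ` \<Omega>) * C powr r * sobolev0_norm E \<omega> \<mu> \<Omega> l u powr r
      + Max ((\<lambda>x. \<bar>g x\<bar>) ` \<Omega>) * C * sobolev0_norm E \<omega> \<mu> \<Omega> l u"
proof -
  define N where "N = sobolev0_norm E \<omega> \<mu> \<Omega> l u"
  define H where "H = Max (h ` \<Omega>)"
  define G where "G = Max ((\<lambda>x. \<bar>g x\<bar>) ` \<Omega>)"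
  \<comment> \<open>For \<open>k = 0\<close> the case distinction in \<open>kirchhoff\<close>
    supplies the factor 1; otherwise the exponents \<open>l * k\<close> and \<open>l\<close> add
    up.\<close>
  have "a * N powr l + b * N powr (l * (k + 1)) = kirchhoff a b k (N powr l) * N powr l"
    by (simp add: kirchhoff_def powr_powr algebra_simps flip: powr_add)
  also have "\<dots> = (\<Sum>x\<in>\<Omega>. \<mu> x * (- kirchhoff a b k (N powr l) * graph_laplacian E \<omega> \<mu> l u x) * u x)"
  proof -
    have "N powr l = - (\<Sum>x\<in>\<Omega>. \<mu> x * (graph_laplacian E \<omega> \<mu> l u x * u x))"
      using sobolev0_norm_powr_eq_laplacian[OF fin u \<open>l > 0\<close>] by (simp add: N_def vertex_integral_def)
    \<comment> \<open>The Kirchhoff factor is nonlocal but constant in \<open>x\<close>, so it moves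
      into the sum and the pointwise equation can be inserted.\<close>
    then have "K * N powr l = (\<Sum>x\<in>\<Omega>. \<mu> x * (- K * graph_laplacian E \<omega> \<mu> l u x) * u x)" for K
      by (simp add: sum_distrib_left sum_negf algebra_simps)
    then show ?thesis .
  qed
  also have "\<dots> = (\<Sum>x\<in>\<Omega>. \<mu> x * (lam * h x * signed_power r (u x) + g x) * u x)"
    by (rule sum.cong[OF refl]) (simp only: N_def eq)
  \<comment> \<open>The exponent 1 is written as \<open>powr 1\<close> so that both terms fit the
    embedding, with exponents \<open>r\<close> and 1.\<close>
  also have "\<dots> \<le> (\<Sum>x\<in>\<Omega>. lam * H * (\<mu> x * \<bar>u x\<bar> powr r) + G * (\<mu> x * \<bar>u x\<bar> powr 1))"
  proof (rule sum_mono)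
    fix x
    assume x: "x \<in> \<Omega>"
    have "signed_power r (u x) * u x = \<bar>u x\<bar> powr (r - 2) * \<bar>u x\<bar> powr 2"
      by (simp add: signed_power_def power2_eq_square)
    also have "\<dots> = \<bar>u x\<bar> powr r"
      by (metis powr_add diff_add_cancel)
    finally have "(lam * h x * signed_power r (u x) + g x) * u x = lam * (h x * \<bar>u x\<bar> powr r) + g x * u x"
      by (simp add: algebra_simps)
    also have "\<dots> \<le> lam * (H * \<bar>u x\<bar> powr r) + G * \<bar>u x\<bar>"
    proof (rule add_mono)
      have "h x \<le> H"
        using x fin by (simp add: H_def)
      then show "lam * (h x * \<bar>u x\<bar> powr r) \<le> lam * (H * \<bar>u x\<bar> powr r)"
        using \<open>lam \<ge> 0\<close> by (intro mult_left_mono mult_right_mono) auto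
      \<comment> \<open>Both \<open>g\<close> and \<open>u\<close> may be negative, so the product
        is controlled through \<open>\<bar>g x\<bar>\<close>, not through an upper bound of
        \<open>g\<close>.\<close>
      have "\<bar>g x\<bar> \<le> G"
        using x fin by (simp add: G_def)
      then have "\<bar>g x\<bar> * \<bar>u x\<bar> \<le> G * \<bar>u x\<bar>"
        by (rule mult_right_mono) simp
      then show "g x * u x \<le> G * \<bar>u x\<bar>"
        by (metis abs_ge_self abs_mult order_trans)
    qed
    finally have "\<mu> x * ((lam * h x * signed_power r (u x) + g x) * u x)
        \<le> \<mu> x * (lam * (H * \<bar>u x\<bar> powr r) + G * \<bar>u x\<bar>)"
      using measure_pos[of x] by (intro mult_left_mono) auto
    then show "\<mu> x * (lam * h x * signed_power r (u x) + g x) * u x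
        \<le> lam * H * (\<mu> x * \<bar>u x\<bar> powr r) + G * (\<mu> x * \<bar>u x\<bar> powr 1)"
      by (simp add: algebra_simps)
  qed
  also have "\<dots> = lam * H * vertex_integral \<mu> \<Omega> (\<lambda>x. \<bar>u x\<bar> powr r)
      + G * vertex_integral \<mu> \<Omega> (\<lambda>x. \<bar>u x\<bar> powr 1)"
    unfolding vertex_integral_def by (simp only: sum.distrib sum_distrib_left)
  also have "\<dots> \<le> lam * H * (C powr r * N powr r) + G * (C powr 1 * N powr 1)"
  proof (intro add_mono mult_left_mono embedding_integral_le[OF C u, folded N_def])
    \<comment> \<open>Multiplying the embedding bounds requires nonnegative coefficients; any vertex
      of \<Omega> bounds the two maxima from below by nonnegative values.\<close>
    obtain x where x: "x \<in> \<Omega>"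
      using \<open>\<Omega> \<noteq> {}\<close> by blast
    have "H \<ge> h x" and "G \<ge> \<bar>g x\<bar>"
      using x fin by (auto simp: H_def G_def)
    then show "lam * H \<ge> 0" and "G \<ge> 0"
      using \<open>lam \<ge> 0\<close> h[OF x] by auto
  qed (use \<open>r \<ge> 1\<close> in auto)
  also have "C powr 1 * N powr 1 = C * N"
    using C by (simp add: embedding_constant_def N_def sobolev0_norm_def)
  finally show ?thesis
    by (simp add: N_def H_def G_def algebra_simps)
qed

end

text \<open>\<open>G\<^sub>1\<close> and \<open>G\<^sub>2\<close> are maxima of absolute values. For
  sign-changing data \<open>g u\<close> can be positive where \<open>g\<close> is negative, so the
  plain maximum of \<open>g\<close> would not dominate the source term.\<close>

theorem theorem1p2:
  fixes E :: "('v \<times> 'v) set" and \<omega> :: "'v \<Rightarrow> 'v \<Rightarrow> real" and \<mu> :: "'v \<Rightarrow> real" and \<Omega> :: "'v set"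
    and p q r lam\<^sub>1 lam\<^sub>2 \<alpha> \<beta> k a\<^sub>1 b\<^sub>1 a\<^sub>2 b\<^sub>2 H\<^sub>1 H\<^sub>3 G\<^sub>1 G\<^sub>2 C\<^sub>p C\<^sub>q :: real
    and h\<^sub>1 h\<^sub>2 h\<^sub>3 g\<^sub>1 g\<^sub>2 :: "'v \<Rightarrow> real"
    and M\<^sub>1 M\<^sub>2 :: "real \<Rightarrow> real"
  assumes "weighted_graph E \<omega> \<mu>"
    and "bounded_domain E \<Omega>"
    and "vertex_interior E \<Omega> \<noteq> {}" and "vertex_boundary E \<Omega> \<noteq> {}"
    and "p > 1" and "q > 1" and "r > 1"
    and "lam\<^sub>1 > 0" and "lam\<^sub>2 > 0" and "\<alpha> > 0" and "\<beta> > 0" and "k \<ge> 0"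
    and "r < min p q" and "min p q \<le> (k + 1) * max p q" and "(k + 1) * max p q < \<alpha> + \<beta>"
    and "a\<^sub>1 > 0" and "b\<^sub>1 > 0" and "a\<^sub>2 > 0" and "b\<^sub>2 > 0"
    and "\<And>x. x \<in> \<Omega> \<Longrightarrow> h\<^sub>1 x > 0" and "\<And>x. x \<in> \<Omega> \<Longrightarrow> h\<^sub>2 x > 0" and "\<And>x. x \<in> \<Omega> \<Longrightarrow> h\<^sub>3 x > 0"
    and "embedding_constant E \<omega> \<mu> \<Omega> p C\<^sub>p" and "embedding_constant E \<omega> \<mu> \<Omega> q C\<^sub>q"
  defines "M\<^sub>1 \<equiv> kirchhoff a\<^sub>1 b\<^sub>1 k" and "M\<^sub>2 \<equiv> kirchhoff a\<^sub>2 b\<^sub>2 k"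
    and "H\<^sub>1 \<equiv> Max (h\<^sub>1 ` \<Omega>)" and "H\<^sub>3 \<equiv> Max (h\<^sub>3 ` \<Omega>)"
    and "G\<^sub>1 \<equiv> Max ((\<lambda>x. \<bar>g\<^sub>1 x\<bar>) ` \<Omega>)" and "G\<^sub>2 \<equiv> Max ((\<lambda>x. \<bar>g\<^sub>2 x\<bar>) ` \<Omega>)"
  shows "(\<forall>u\<^sub>0. semitrivial_solution E \<omega> \<mu> \<Omega> M\<^sub>1 M\<^sub>2 p q r lam\<^sub>1 lam\<^sub>2 \<alpha> \<beta> h\<^sub>1 h\<^sub>2 h\<^sub>3 g\<^sub>1 g\<^sub>2 u\<^sub>0 (\<lambda>_. 0) \<longrightarrow>
            a\<^sub>1 * sobolev0_norm E \<omega> \<mu> \<Omega> p u\<^sub>0 powr p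
              + b\<^sub>1 * sobolev0_norm E \<omega> \<mu> \<Omega> p u\<^sub>0 powr (p * (k + 1))
            \<le> lam\<^sub>1 * H\<^sub>1 * C\<^sub>p powr r * sobolev0_norm E \<omega> \<mu> \<Omega> p u\<^sub>0 powr r
              + G\<^sub>1 * C\<^sub>p * sobolev0_norm E \<omega> \<mu> \<Omega> p u\<^sub>0) \<and>
         (\<forall>v\<^sub>0. semitrivial_solution E \<omega> \<mu> \<Omega> M\<^sub>1 M\<^sub>2 p q r lam\<^sub>1 lam\<^sub>2 \<alpha> \<beta> h\<^sub>1 h\<^sub>2 h\<^sub>3 g\<^sub>1 g\<^sub>2 (\<lambda>_. 0) v\<^sub>0 \<longrightarrow>
            a\<^sub>2 * sobolev0_norm E \<omega> \<mu> \<Omega> q v\<^sub>0 powr q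
              + b\<^sub>2 * sobolev0_norm E \<omega> \<mu> \<Omega> q v\<^sub>0 powr (q * (k + 1))
            \<le> lam\<^sub>2 * H\<^sub>3 * C\<^sub>q powr r * sobolev0_norm E \<omega> \<mu> \<Omega> q v\<^sub>0 powr r
              + G\<^sub>2 * C\<^sub>q * sobolev0_norm E \<omega> \<mu> \<Omega> q v\<^sub>0)"
proof -
  interpret weighted_graph E \<omega> \<mu>
    by fact
  have fin: "finite \<Omega>"
    using assms(2) by (rule finite_bounded_domain)
  \<comment> \<open>The interior is a subset of \<Omega>; nonemptiness makes the maxima over
    \<Omega> meaningful.\<close>
  have ne: "\<Omega> \<noteq> {}"
    using assms(3) by (auto simp: vertex_interior_def)
  show ?thesis
    unfolding H\<^sub>1_def H\<^sub>3_def G\<^sub>1_def G\<^sub>2_def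
  proof (intro conjI allI impI)
    fix u\<^sub>0
    assume "semitrivial_solution E \<omega> \<mu> \<Omega> M\<^sub>1 M\<^sub>2 p q r lam\<^sub>1 lam\<^sub>2 \<alpha> \<beta> h\<^sub>1 h\<^sub>2 h\<^sub>3 g\<^sub>1 g\<^sub>2 u\<^sub>0 (\<lambda>_. 0)"
    then have sol: "kirchhoff_solution E \<omega> \<mu> \<Omega> M\<^sub>1 M\<^sub>2 p q r lam\<^sub>1 lam\<^sub>2 \<alpha> \<beta> h\<^sub>1 h\<^sub>2 h\<^sub>3 g\<^sub>1 g\<^sub>2 u\<^sub>0 (\<lambda>_. 0)"
      by (simp add: semitrivial_solution_def)
    show "a\<^sub>1 * sobolev0_norm E \<omega> \<mu> \<Omega> p u\<^sub>0 powr p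
        + b\<^sub>1 * sobolev0_norm E \<omega> \<mu> \<Omega> p u\<^sub>0 powr (p * (k + 1))
      \<le> lam\<^sub>1 * Max (h\<^sub>1 ` \<Omega>) * C\<^sub>p powr r * sobolev0_norm E \<omega> \<mu> \<Omega> p u\<^sub>0 powr r
        + Max ((\<lambda>x. \<bar>g\<^sub>1 x\<bar>) ` \<Omega>) * C\<^sub>p * sobolev0_norm E \<omega> \<mu> \<Omega> p u\<^sub>0"
      \<comment> \<open>With zero second component the coupling term carries the factor
        \<open>0 powr \<beta> = 0\<close>, which leaves the scalar equation.\<close>
      by (rule kirchhoff_equation_estimate[OF fin ne])
         (use assms sol in \<open>auto simp: kirchhoff_solution_def less_imp_le\<close>)
  next
    fix v\<^sub>0
    assume "semitrivial_solution E \<omega> \<mu> \<Omega> M\<^sub>1 M\<^sub>2 p q r lam\<^sub>1 lam\<^sub>2 \<alpha> \<beta> h\<^sub>1 h\<^sub>2 h\<^sub>3 g\<^sub>1 g\<^sub>2 (\<lambda>_. 0) v\<^sub>0"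
    then have sol: "kirchhoff_solution E \<omega> \<mu> \<Omega> M\<^sub>1 M\<^sub>2 p q r lam\<^sub>1 lam\<^sub>2 \<alpha> \<beta> h\<^sub>1 h\<^sub>2 h\<^sub>3 g\<^sub>1 g\<^sub>2 (\<lambda>_. 0) v\<^sub>0"
      by (simp add: semitrivial_solution_def)
    show "a\<^sub>2 * sobolev0_norm E \<omega> \<mu> \<Omega> q v\<^sub>0 powr q
        + b\<^sub>2 * sobolev0_norm E \<omega> \<mu> \<Omega> q v\<^sub>0 powr (q * (k + 1))
      \<le> lam\<^sub>2 * Max (h\<^sub>3 ` \<Omega>) * C\<^sub>q powr r * sobolev0_norm E \<omega> \<mu> \<Omega> q v\<^sub>0 powr r
        + Max ((\<lambda>x. \<bar>g\<^sub>2 x\<bar>) ` \<Omega>) * C\<^sub>q * sobolev0_norm E \<omega> \<mu> \<Omega> q v\<^sub>0"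
      \<comment> \<open>Here the vanishing coupling factor is
        \<open>0 powr \<alpha>\<close>.\<close>
      by (rule kirchhoff_equation_estimate[OF fin ne])
         (use assms sol in \<open>auto simp: kirchhoff_solution_def less_imp_le\<close>)
  qed
qed

end
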